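(* Let $F(s)=\sum_{n\geqslant 1} f(n)n^{-s}$ be a nondegenerate ordinary Dirichlet series with $f(n)\geqslant 0$ for all $n$, which is convergent for $\Re(s)\geqslant s_0$ (where $s_0\in\mathbb{R}$). Let $R$ be an integer with $R\geqslant s_0-2$, and suppose that $F(k)\in\mathbb{Q}$ for all integers $k\geqslant R$ (in particular, the series converges at each such $k$). For each integer $k\geqslant R$, define the pair of coprime positive integers $p_k$ and $q_k$ by $p_k/q_k=F(k)$, and for integers $m\geqslant 2$ set $$D_m[F]=\mathrm{lcm}(q_{R+2},q_{R+3},\ldots,q_{R+m}).$$ Then $D_m[F]$ grows at least exponentially in $m$; that is, there is a constant $C>1$ such that $D_m[F]\geqslant C^m$ for all sufficiently large $m$.
   Context: An ordinary Dirichlet series is a series $F(s)=\sum_{n\geqslant 1} f(n)n^{-s}$. It is called nondegenerate if infinitely many of the coefficients $f(n)$ are nonzero. *)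

theory Defs
  imports "HOL-Analysis.Analysis"
begin

text \<open>
  Dirichlet series are indexed by positive integers, so the coefficient \<open>a 0\<close> is never used;
  the \<open>i\<close>-th term (from \<open>i = 0\<close>) is the one for \<open>n = i + 1\<close>.
\<close>

definition dirichlet_term :: "(nat \<Rightarrow> complex) \<Rightarrow> complex \<Rightarrow> nat \<Rightarrow> complex" where
  "dirichlet_term a s n = a n * of_nat n powr (- s)"

definition dirichlet_converges :: "(nat \<Rightarrow> complex) \<Rightarrow> complex \<Rightarrow> bool" where
  "dirichlet_converges a s \<longleftrightarrow> summable (\<lambda>i. dirichlet_term a s (Suc i))"

definition dirichlet_series :: "(nat \<Rightarrow> complex) \<Rightarrow> complex \<Rightarrow> complex" where
  "dirichlet_series a s = (\<Sum>i. dirichlet_term a s (Suc i))"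

definition nondegenerate :: "(nat \<Rightarrow> complex) \<Rightarrow> bool" where
  "nondegenerate a \<longleftrightarrow> infinite {n. n \<ge> 1 \<and> a n \<noteq> 0}"

definition denominator_lcm :: "(int \<Rightarrow> nat) \<Rightarrow> int \<Rightarrow> nat \<Rightarrow> nat" where
  "denominator_lcm q R m = Lcm ((\<lambda>j. q (R + int j)) ` {2..m})"

end

theory Submission
  imports Defs
begin

text \<open>
  The idea is to evaluate small integer polynomials at the points \<open>1/n\<close>. For
  \<open>P(x) = \<Sum>j. c\<^sub>j x^j\<close> with integer coefficients and only exponents \<open>2 \<le> j \<le> m\<close>, the number
  \<open>S = \<Sum>j. c\<^sub>j F(R+j) = \<Sum>n. f(n) n^(-R) P(1/n)\<close> is rational and becomes an integer after
  multiplication by \<open>D\<^sub>m\<close>. If moreover \<open>P \<ge> 0\<close> on \<open>[0,1]\<close> and \<open>P(1/n) > 0\<close> for some \<open>n\<close> with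
  \<open>f(n) > 0\<close>, then \<open>S > 0\<close>, hence \<open>D\<^sub>m S \<ge> 1\<close>: any upper bound for \<open>S\<close> turns into a lower bound
  for \<open>D\<^sub>m\<close>.

  The choice \<open>P(x) = x\<^sup>2 (x (1 - x))^N\<close> with \<open>2 N + 2 \<le> m\<close> works, because \<open>x (1 - x) \<le> 1/4\<close> on
  \<open>[0,1]\<close> and \<open>P\<close> vanishes there only at the end points; nondegeneracy supplies an \<open>n \<ge> 2\<close> with
  \<open>f(n) > 0\<close>. Thus \<open>S \<le> F(R+2) / 4^N\<close> and \<open>D\<^sub>m \<ge> 4^N / F(R+2)\<close>, which is at least a constant
  times \<open>2^m\<close>. Any \<open>C\<close> strictly between \<open>1\<close> and \<open>2\<close> then absorbs the constant.

  The argument concerns the moments \<open>\<Sum>i. w i * x i ^ j\<close> of an arbitrary nonnegative weight on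
  \<open>[0,1]\<close>, and is carried out in that form.
\<close>

text \<open>
  Multiplication by \<open>1 - x\<close> replaces a sequence of moments by its differences, so the coefficients
  of \<open>x^j (1 - x)^N\<close> never have to be written out.
\<close>
lemma moment_difference_sums_Ints:
  fixes w x M :: "nat \<Rightarrow> real" and d :: real
  assumes "\<And>k. j \<le> k \<Longrightarrow> k \<le> j + N \<Longrightarrow> (\<lambda>i. w i * x i ^ k) sums M k"
    and "\<And>k. j \<le> k \<Longrightarrow> k \<le> j + N \<Longrightarrow> d * M k \<in> \<int>"
  shows "\<exists>S. (\<lambda>i. w i * (x i ^ j * (1 - x i) ^ N)) sums S \<and> d * S \<in> \<int>"
  using assms
proof (induction N arbitrary: j)
  case 0
  then show ?case by force
next
  case (Suc N)
  obtain S where S: "(\<lambda>i. w i * (x i ^ j * (1 - x i) ^ N)) sums S" "d * S \<in> \<int>"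
    using Suc.IH[of j] Suc.prems by auto
  obtain T where T: "(\<lambda>i. w i * (x i ^ Suc j * (1 - x i) ^ N)) sums T" "d * T \<in> \<int>"
    using Suc.IH[of "Suc j"] Suc.prems by auto
  have "(\<lambda>i. w i * (x i ^ j * (1 - x i) ^ N) - w i * (x i ^ Suc j * (1 - x i) ^ N)) sums (S - T)"
    using S(1) T(1) by (rule sums_diff)
  then have "(\<lambda>i. w i * (x i ^ j * (1 - x i) ^ Suc N)) sums (S - T)"
    by (simp add: algebra_simps)
  moreover have "d * (S - T) \<in> \<int>"
    using S(2) T(2) by (simp add: right_diff_distrib)
  ultimately show ?case by blast
qed

lemma mult_one_minus_le_quarter:
  fixes x :: real
  shows "x * (1 - x) \<le> 1 / 4"
  using zero_le_power2[of "x - 1 / 2"] by (simp add: power2_eq_square algebra_simps)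

text \<open>
  The positive number \<open>\<Sum>i. w i * x i ^ 2 * (x i * (1 - x i)) ^ N\<close> is at most \<open>M 2 / 4 ^ N\<close>, yet
  \<open>d\<close> times it is a positive integer.
\<close>
lemma common_denominator_of_moments_ge:
  fixes w x M :: "nat \<Rightarrow> real" and d :: real
  assumes sums: "\<And>k. 2 \<le> k \<Longrightarrow> k \<le> 2 * N + 2 \<Longrightarrow> (\<lambda>i. w i * x i ^ k) sums M k"
    and Ints: "\<And>k. 2 \<le> k \<Longrightarrow> k \<le> 2 * N + 2 \<Longrightarrow> d * M k \<in> \<int>"
    and w: "\<And>i. w i \<ge> 0"
    and x: "\<And>i. 0 \<le> x i" "\<And>i. x i \<le> 1"
    and l: "w l > 0" "0 < x l" "x l < 1"
    and "d > 0"
  shows "4 ^ N \<le> d * M 2"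
proof -
  obtain S where S: "(\<lambda>i. w i * (x i ^ (N + 2) * (1 - x i) ^ N)) sums S" "d * S \<in> \<int>"
    using moment_difference_sums_Ints[of "N + 2" N w x M d] sums Ints by auto
  have "S = (\<Sum>i. w i * (x i ^ (N + 2) * (1 - x i) ^ N))"
    using S(1) by (rule sums_unique)
  also have "\<dots> > 0"
  proof (rule suminf_pos2)
    show "0 \<le> w i * (x i ^ (N + 2) * (1 - x i) ^ N)" for i
      using w x by simp
    show "0 < w l * (x l ^ (N + 2) * (1 - x l) ^ N)"
      using l by simp
  qed (use S(1) in \<open>simp add: sums_iff\<close>)
  finally have "d * S > 0"
    using \<open>d > 0\<close> by simp
  then have ge1: "d * S \<ge> 1"
    using S(2) by (auto elim!: Ints_cases)
  have "S \<le> M 2 * (1 / 4) ^ N"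
  proof (rule sums_le[OF _ S(1)])
    show "(\<lambda>i. w i * x i ^ 2 * (1 / 4) ^ N) sums (M 2 * (1 / 4) ^ N)"
      using sums by (intro sums_mult2) simp
    fix i
    have "(x i * (1 - x i)) ^ N \<le> (1 / 4) ^ N"
      using x[of i] by (intro power_mono mult_one_minus_le_quarter) simp
    then have "w i * x i ^ 2 * (x i * (1 - x i)) ^ N \<le> w i * x i ^ 2 * (1 / 4) ^ N"
      using w by (intro mult_left_mono) simp_all
    then show "w i * (x i ^ (N + 2) * (1 - x i) ^ N) \<le> w i * x i ^ 2 * (1 / 4) ^ N"
      by (simp add: power_mult_distrib power_add power2_eq_square mult_ac)
  qed
  then have "d * S \<le> d * (M 2 * (1 / 4) ^ N)"
    using \<open>d > 0\<close> by simp
  then have "1 \<le> d * (M 2 * (1 / 4) ^ N)"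
    using ge1 by linarith
  then show ?thesis
    by (simp add: field_simps)
qed

text \<open>
  The values \<open>F(R+j)\<close> are the \<open>j\<close>-th moments of the weight \<open>f(n) n^(-R)\<close> placed at the points
  \<open>1/n\<close>.
\<close>
lemma dirichlet_term_eq_moment:
  assumes "a (Suc i) \<in> \<real>\<^sub>\<ge>\<^sub>0"
  shows "dirichlet_term a (of_int (R + int j)) (Suc i) =
    of_real (Re (a (Suc i)) * real (Suc i) powr (- of_int R) * (1 / real (Suc i)) ^ j)"
proof -
  let ?n = "real (Suc i)"
  have a: "a (Suc i) = of_real (Re (a (Suc i)))"
    using assms by (auto elim!: nonneg_Reals_cases)
  have "(of_nat (Suc i) :: complex) powr (- of_int (R + int j)) =
      of_real ?n powr of_real (- of_int (R + int j))"
    by simp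
  also have "\<dots> = of_real (?n powr (- of_int (R + int j)))"
    by (rule powr_of_real) simp_all
  also have "?n powr (- of_int (R + int j)) = ?n powr (- of_int R) * ?n powr (- real j)"
    by (simp flip: powr_add)
  also have "?n powr (- real j) = (1 / ?n) ^ j"
    by (simp add: powr_minus powr_realpow power_inverse divide_inverse del: of_nat_Suc)
  finally show ?thesis
    unfolding dirichlet_term_def by (subst a) (simp add: mult.assoc del: of_nat_Suc)
qed

theorem theorem1p2:
  fixes f :: "nat \<Rightarrow> complex" and s0 :: real and R :: int and p q :: "int \<Rightarrow> nat"
  assumes "nondegenerate f"
    and "\<And>n. n \<ge> 1 \<Longrightarrow> f n \<in> \<real>\<^sub>\<ge>\<^sub>0"
    and "\<And>s. Re s \<ge> s0 \<Longrightarrow> dirichlet_converges f s"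
    and "real_of_int R \<ge> s0 - 2"
    and "\<And>k. k \<ge> R \<Longrightarrow> dirichlet_converges f (of_int k)"
    and "\<And>k. k \<ge> R \<Longrightarrow> dirichlet_series f (of_int k) \<in> \<rat>"
    and "\<And>k. k \<ge> R \<Longrightarrow> p k > 0 \<and> q k > 0 \<and> coprime (p k) (q k) \<and>
           of_nat (p k) / of_nat (q k) = dirichlet_series f (of_int k)"
  shows "\<exists>C::real. C > 1 \<and>
           (\<forall>\<^sub>F m in sequentially. real (denominator_lcm q R m) \<ge> C ^ m)"
proof -
  define w where "w i = Re (f (Suc i)) * real (Suc i) powr (- of_int R)" for i
  define x where "x i = 1 / real (Suc i)" for i
  define M where "M j = real (p (R + int j)) / real (q (R + int j))" for j
  have w: "w i \<ge> 0" for i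
    using assms(2)[of "Suc i"] by (auto simp: w_def complex_nonneg_Reals_iff)
  have x: "0 \<le> x i" "x i \<le> 1" for i
    by (simp_all add: x_def)
  \<comment> \<open>The first term is excluded since the test polynomial vanishes at \<open>1\<close>.\<close>
  obtain n where n: "n > 1" "f n \<noteq> 0"
    using assms(1) unfolding nondegenerate_def infinite_nat_iff_unbounded by blast
  define l where "l = n - 1"
  have l: "w l > 0" "0 < x l" "x l < 1"
  proof -
    have "Re (f n) > 0"
      using assms(2)[of n] n by (auto simp: complex_nonneg_Reals_iff complex_eq_iff less_le)
    then show "w l > 0" "0 < x l" "x l < 1"
      using n by (simp_all add: w_def x_def l_def)
  qed
  have sums: "(\<lambda>i. w i * x i ^ j) sums M j" for j
  proof -
    have "(\<lambda>i. dirichlet_term f (of_int (R + int j)) (Suc i)) sums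
        dirichlet_series f (of_int (R + int j))"
      using assms(5)[of "R + int j"]
      unfolding dirichlet_converges_def dirichlet_series_def by (simp add: summable_sums)
    also have "dirichlet_series f (of_int (R + int j)) = of_real (M j)"
      using assms(7)[of "R + int j"] by (simp add: M_def)
    also have "(\<lambda>i. dirichlet_term f (of_int (R + int j)) (Suc i)) =
        (\<lambda>i. of_real (w i * x i ^ j))"
      using dirichlet_term_eq_moment[of f] assms(2) by (simp add: w_def x_def del: of_nat_Suc)
    finally show ?thesis
      by (simp only: sums_of_real_iff)
  qed
  have M2: "M 2 > 0"
    using assms(7)[of "R + 2"] by (simp add: M_def)
  have lower: "2 ^ m \<le> 8 * M 2 * real (denominator_lcm q R m)" if "m \<ge> 2" for m
  proof -
    let ?D = "denominator_lcm q R m"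
    define N where "N = (m - 2) div 2"
    have N: "2 * N + 2 \<le> m" "m \<le> 2 * N + 3"
      using that by (auto simp: N_def)
    have "0 \<noteq> q (R + int j)" for j
      using assms(7)[of "R + int j"] by simp
    then have "0 \<notin> (\<lambda>j. q (R + int j)) ` {2..m}"
      by blast
    then have "?D > 0"
      unfolding denominator_lcm_def by (intro gr0I) (simp add: Lcm_0_iff)
    moreover have "real ?D * M k \<in> \<int>" if k: "2 \<le> k" "k \<le> 2 * N + 2" for k
    proof -
      have "q (R + int k) dvd ?D"
        unfolding denominator_lcm_def using k N by (intro dvd_Lcm) auto
      then obtain c where "?D = q (R + int k) * c" ..
      then have "real ?D * M k = of_nat (c * p (R + int k))"
        using assms(7)[of "R + int k"] by (simp add: M_def)
      then show ?thesis
        by (metis Ints_of_nat)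
    qed
    ultimately have "4 ^ N \<le> real ?D * M 2"
      using common_denominator_of_moments_ge[of N w x M "real ?D" l] sums w x l by auto
    then have "8 * 4 ^ N \<le> 8 * M 2 * real ?D"
      by (simp add: mult_ac)
    moreover have "(2::real) ^ m \<le> 2 ^ (2 * N + 3)"
      using N by (intro power_increasing) simp_all
    moreover have "(2::real) ^ (2 * N + 3) = 8 * 4 ^ N"
      by (simp add: power_add power_mult)
    ultimately show ?thesis
      by linarith
  qed
  \<comment> \<open>Any base strictly between \<open>1\<close> and \<open>2\<close> would do as well as \<open>3/2\<close>:
    the ratio \<open>2^m / (3/2)^m = (4/3)^m\<close> eventually exceeds \<open>8 * M 2\<close>.\<close>
  obtain m0 where m0: "8 * M 2 < (4 / 3) ^ m0"
    using real_arch_pow[of "4 / 3" "8 * M 2"] by auto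
  have "(3 / 2) ^ m \<le> real (denominator_lcm q R m)" if "m \<ge> max 2 m0" for m
  proof -
    have "(4 / 3 :: real) ^ m0 \<le> (4 / 3) ^ m"
      using that by (intro power_increasing) simp_all
    with m0 have "8 * M 2 \<le> (4 / 3) ^ m"
      by linarith
    then have "8 * M 2 * (3 / 2) ^ m \<le> (4 / 3) ^ m * (3 / 2) ^ m"
      by (intro mult_right_mono) simp_all
    also have "\<dots> = (2::real) ^ m"
      by (simp flip: power_mult_distrib)
    also have "\<dots> \<le> 8 * M 2 * real (denominator_lcm q R m)"
      using lower that by simp
    finally show ?thesis
      using M2 by simp
  qed
  then have "\<forall>\<^sub>F m in sequentially. (3 / 2) ^ m \<le> real (denominator_lcm q R m)"
    unfolding eventually_sequentially by blast
  then show ?thesis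
    by (intro exI[of _ "3 / 2"]) simp
qed

end
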